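(* Let $\mathbf z=\mathbf h(d+\eta_t^{\mathrm{UE}})+\boldsymbol\eta_r^{\mathrm{BS}}+\boldsymbol\nu$ be the uplink pilot observation described in the context. The linear minimum mean square error (LMMSE) estimator of $\mathbf h$ from $\mathbf z$ (i.e., the estimator of the form $\hat{\mathbf h}=\mathbf A\mathbf z$, $\mathbf A\in\mathbb C^{N\times N}$, minimizing $\mathbb E\{\|\hat{\mathbf h}-\mathbf h\|_2^2\}$) is $$\hat{\mathbf h}=\mathbf A\mathbf z,\qquad \mathbf A= d^*\,\mathbf R\,\bar{\mathbf Z}^{-1},$$ where $\mathbf R_{\mathrm{diag}}=\mathrm{diag}(r_{11},\dots,r_{NN})$ consists of the diagonal elements of $\mathbf R$ and $$\bar{\mathbf Z}=\mathbb E\{\mathbf z\mathbf z^H\}=p^{\mathrm{UE}}(1+\kappa_t^{\mathrm{UE}})\mathbf R+p^{\mathrm{UE}}\kappa_r^{\mathrm{BS}}\mathbf R_{\mathrm{diag}}+\mathbf S+\sigma_{\mathrm{BS}}^2\mathbf I .$$ The total MSE is $\mathrm{MSE}=\mathbb E\{\|\hat{\mathbf h}-\mathbf h\|_2^2\}=\mathrm{tr}(\mathbf C)$, where the error covariance matrix is $$\mathbf C=\mathbb E\{(\hat{\mathbf h}-\mathbf h)(\hat{\mathbf h}-\mathbf h)^H\}=\mathbf R-p^{\mathrm{UE}}\,\mathbf R\bar{\mathbf Z}^{-1}\mathbf R .$$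
   Context: $\mathbf h=[h_1\,\dots\,h_N]^T\sim\mathcal{CN}(\mathbf 0,\mathbf R)$ is the channel, with positive semi-definite covariance $\mathbf R\in\mathbb C^{N\times N}$ having diagonal entries $r_{ii}$. The pilot $d\in\mathbb C$ is deterministic and known, $p^{\mathrm{UE}}=|d|^2$. For given $\mathbf h$, the distortion noises are independent with $\eta_t^{\mathrm{UE}}\sim\mathcal{CN}(0,\kappa_t^{\mathrm{UE}}p^{\mathrm{UE}})$ and $\boldsymbol\eta_r^{\mathrm{BS}}\sim\mathcal{CN}(\mathbf 0,\kappa_r^{\mathrm{BS}}p^{\mathrm{UE}}\,\mathrm{diag}(|h_1|^2,\dots,|h_N|^2))$, where $\kappa_t^{\mathrm{UE}},\kappa_r^{\mathrm{BS}}\ge 0$ are constants. The term $\boldsymbol\nu=\boldsymbol\nu_{\mathrm{noise}}+\boldsymbol\nu_{\mathrm{interf}}$ consists of independent receiver noise $\boldsymbol\nu_{\mathrm{noise}}\sim\mathcal{CN}(\mathbf 0,\sigma_{\mathrm{BS}}^2\mathbf I)$, $\sigma_{\mathrm{BS}}^2>0$, and zero-mean interference $\boldsymbol\nu_{\mathrm{interf}}$ with positive semi-definite covariance $\mathbf S$; $\boldsymbol\nu$ is independent of $\mathbf h$ and of the distortion noises. $(\cdot)^*$ is the complex conjugate and $(\cdot)^H$ the conjugate transpose. *)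

theory Defs
  imports "HOL-Probability.Probability"
begin

definition ctranspose :: "complex^'n^'m \<Rightarrow> complex^'m^'n" where
  "ctranspose A = (\<chi> i j. cnj (A $ j $ i))"

definition outer :: "complex^'m \<Rightarrow> complex^'n \<Rightarrow> complex^'n^'m" where
  "outer x y = (\<chi> i j. x $ i * cnj (y $ j))"

definition cinner :: "complex^'n \<Rightarrow> complex^'n \<Rightarrow> complex" where
  "cinner c x = (\<Sum>i\<in>UNIV. cnj (c $ i) * x $ i)"

definition diag_mat :: "complex^'n \<Rightarrow> complex^'n^'n" where
  "diag_mat x = (\<chi> i j. if i = j then x $ i else 0)"

definition psd :: "complex^'n^'n \<Rightarrow> bool" where
  "psd A \<longleftrightarrow> ctranspose A = A \<and> (\<forall>c. 0 \<le> Re (cinner c (A *v c)))"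

(* The scalar law CN(0,v): independent real and imaginary parts, each N(0,v/2).
   For v = 0 this is the point mass at 0. *)
definition complex_normal :: "real \<Rightarrow> complex measure" where
  "complex_normal v =
     distr (std_normal_distribution \<Otimes>\<^sub>M std_normal_distribution) borel
       (\<lambda>(a, b). complex_of_real (sqrt (v / 2)) * Complex a b)"

(* The law CN(0,R), where R may be singular (so that there need not be a density):
   every complex linear combination c^H x is a scalar CN(0, c^H R c). *)
definition complex_normal_vec :: "(complex^'n) measure \<Rightarrow> complex^'n^'n \<Rightarrow> bool" where
  "complex_normal_vec \<mu> R \<longleftrightarrow>
     psd R \<and> sets \<mu> = sets borel \<and>
     (\<forall>c. distr \<mu> borel (cinner c) = complex_normal (Re (cinner c (R *v c))))"

definition complex_normal_rv :: "'a measure \<Rightarrow> ('a \<Rightarrow> complex^'n) \<Rightarrow> complex^'n^'n \<Rightarrow> bool" where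
  "complex_normal_rv M X R \<longleftrightarrow>
     X \<in> borel_measurable M \<and> complex_normal_vec (distr M borel X) R"

definition regular_cond_distr ::
  "'a measure \<Rightarrow> ('a \<Rightarrow> 'b::topological_space) \<Rightarrow> ('a \<Rightarrow> 'c::topological_space)
     \<Rightarrow> ('c \<Rightarrow> 'b measure) \<Rightarrow> bool" where
  "regular_cond_distr M X Y K \<longleftrightarrow>
     X \<in> borel_measurable M \<and> Y \<in> borel_measurable M \<and>
     K \<in> measurable borel (prob_algebra borel) \<and>
     (\<forall>A\<in>sets borel. \<forall>B\<in>sets borel.
        emeasure M {\<omega> \<in> space M. Y \<omega> \<in> A \<and> X \<omega> \<in> B} =
        (\<integral>\<^sup>+ \<omega>. indicator A (Y \<omega>) * emeasure (K (Y \<omega>)) B \<partial>M))"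

(* prob_space.indep_var requires both random variables to have the same type. *)
definition indep_rv ::
  "'a measure \<Rightarrow> ('a \<Rightarrow> 'b::topological_space) \<Rightarrow> ('a \<Rightarrow> 'c::topological_space) \<Rightarrow> bool" where
  "indep_rv M X Y \<longleftrightarrow>
     X \<in> borel_measurable M \<and> Y \<in> borel_measurable M \<and>
     prob_space.indep_set M {X -` A \<inter> space M | A. A \<in> sets borel}
                            {Y -` B \<inter> space M | B. B \<in> sets borel}"

definition zero_mean_with_cov :: "'a measure \<Rightarrow> ('a \<Rightarrow> complex^'n) \<Rightarrow> complex^'n^'n \<Rightarrow> bool" where
  "zero_mean_with_cov M X S \<longleftrightarrow>
     X \<in> borel_measurable M \<and> integrable M (\<lambda>\<omega>. (norm (X \<omega>))\<^sup>2) \<and>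
     (\<integral>\<omega>. X \<omega> \<partial>M) = 0 \<and> (\<integral>\<omega>. outer (X \<omega>) (X \<omega>) \<partial>M) = S"

definition mse :: "'a measure \<Rightarrow> ('a \<Rightarrow> complex^'n) \<Rightarrow> ('a \<Rightarrow> complex^'n) \<Rightarrow> real" where
  "mse M x xhat = (\<integral>\<omega>. (norm (xhat \<omega> - x \<omega>))\<^sup>2 \<partial>M)"

(* The Bochner integral of a non-integrable function is 0, so this is meaningful only
   when the squared error is integrable for every matrix B. *)
definition is_lmmse ::
  "'a measure \<Rightarrow> ('a \<Rightarrow> complex^'n) \<Rightarrow> ('a \<Rightarrow> complex^'m) \<Rightarrow> complex^'m^'n \<Rightarrow> bool" where
  "is_lmmse M x y A \<longleftrightarrow> is_arg_min (\<lambda>B. mse M x (\<lambda>\<omega>. B *v y \<omega>)) (\<lambda>_. True) A"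

end

theory Submission
  imports Defs
begin

text \<open>
  Every quantity in question is determined by the second moments of the scalars
  \<open>u\<^sup>H z + w\<^sup>H h\<close>. Given \<open>h = x\<close>, such a scalar is \<open>c\<^sup>H x\<close>, with \<open>c = d\<^sup>* u + w\<close>, plus independent
  centered terms \<open>(u\<^sup>H x) \<eta>\<^sub>t\<close>, \<open>u\<^sup>H \<eta>\<^sub>r\<close> and \<open>u\<^sup>H \<nu>\<close>, so its conditional second moment is a sum of
  quadratic forms in \<open>x\<close>, and averaging over \<open>h\<close> replaces \<open>x x\<^sup>H\<close> by \<open>R\<close>. A Hermitian matrix is
  determined by its quadratic form, which gives the covariance of \<open>z\<close>, and for the error of \<open>B z\<close>,
  after completing the square, \<open>C + (B - A) Z (B - A)\<^sup>H\<close>. As \<open>Z\<close> is positive definite, the trace of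
  this is minimal exactly at \<open>B = A\<close>.
\<close>

section \<open>The sesquilinear form \<open>c^H x\<close>\<close>

lemma cinner_add_right: "cinner c (x + y) = cinner c x + cinner c y"
  by (simp add: cinner_def distrib_left sum.distrib)

lemma cinner_add_left: "cinner (b + c) x = cinner b x + cinner c x"
  by (simp add: cinner_def distrib_right sum.distrib)

lemma cinner_diff_right: "cinner c (x - y) = cinner c x - cinner c y"
  by (simp add: cinner_def right_diff_distrib sum_subtractf)

lemma cinner_diff_left: "cinner (b - c) x = cinner b x - cinner c x"
  by (simp add: cinner_def left_diff_distrib sum_subtractf)

lemma cinner_scale_right: "cinner c (a *s x) = a * cinner c x"
  by (simp add: cinner_def sum_distrib_left mult_ac)

lemma cinner_scale_left: "cinner (a *s c) x = cnj a * cinner c x"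
  by (simp add: cinner_def sum_distrib_left mult_ac)

lemma cinner_scaleR_right: "cinner c (a *\<^sub>R x) = a *\<^sub>R cinner c x"
  by (simp add: cinner_def scaleR_sum_right)

lemma cnj_cinner: "cnj (cinner x y) = cinner y x"
  by (simp add: cinner_def mult.commute)

lemma norm_vec_power2: "(norm (x :: 'a::real_normed_vector^'n))\<^sup>2 = (\<Sum>i\<in>UNIV. (norm (x $ i))\<^sup>2)"
  by (simp add: norm_vec_def L2_set_def sum_nonneg)

lemma cinner_same: "cinner x x = complex_of_real ((norm x)\<^sup>2)"
  by (simp add: cinner_def norm_vec_power2 complex_norm_square mult.commute del: of_real_power)

lemma cinner_matrix_vector_mult: "cinner c (B *v x) = cinner (ctranspose B *v c) x"
proof -
  have "cinner c (B *v x) = (\<Sum>i\<in>UNIV. \<Sum>j\<in>UNIV. cnj (c $ i) * (B $ i $ j * x $ j))"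
    by (simp add: cinner_def matrix_vector_mult_def sum_distrib_left)
  also have "\<dots> = (\<Sum>j\<in>UNIV. \<Sum>i\<in>UNIV. cnj (c $ i) * (B $ i $ j * x $ j))"
    by (rule sum.swap)
  also have "\<dots> = cinner (ctranspose B *v c) x"
    by (simp add: cinner_def matrix_vector_mult_def ctranspose_def sum_distrib_left mult_ac)
  finally show ?thesis .
qed

text \<open>Unit vectors as test vectors turn facts about all forms \<open>c^H x\<close> and
  \<open>c^H A c\<close> into facts about coordinates and diagonal entries.\<close>

lemma cinner_axis: "cinner (axis i 1) x = x $ i"
proof -
  have "cinner (axis i 1) x = (\<Sum>j\<in>UNIV. if j = i then x $ j else 0)"
    unfolding cinner_def by (rule sum.cong) (auto simp: axis_def)
  then show ?thesis by simp
qed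

lemma matrix_vector_mult_axis_nth: "((A :: 'a::comm_semiring_1^'n^'m) *v axis i 1) $ j = A $ j $ i"
proof -
  have "(\<Sum>k\<in>UNIV. A $ j $ k * axis i 1 $ k) = (\<Sum>k\<in>UNIV. if k = i then A $ j $ k else 0)"
    by (rule sum.cong) (auto simp: axis_def)
  then show ?thesis by (simp add: matrix_vector_mult_def)
qed

text \<open>The matrix \<open>x x^H\<close> sends \<open>c\<close> to \<open>(x^H c) x\<close>. This
  links a matrix-valued second moment to the second moments of the scalars
  \<open>c^H x\<close>.\<close>

lemma cinner_outer: "cinner c (outer x x *v c) = complex_of_real ((cmod (cinner c x))\<^sup>2)"
proof -
  have "outer x x *v c = cinner x c *s x"
    by (simp add: vec_eq_iff outer_def matrix_vector_mult_def cinner_def sum_distrib_left mult_ac)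
  then show ?thesis
    by (simp add: cinner_scale_right complex_norm_square cnj_cinner del: of_real_power)
qed

lemma continuous_on_cinner [continuous_intros]: "continuous_on A (cinner c)"
  unfolding cinner_def by (intro continuous_intros)

lemma borel_measurable_cinner [measurable]: "cinner c \<in> borel_measurable borel"
  by (intro borel_measurable_continuous_onI continuous_intros)

section \<open>Centered complex random variables and their variances\<close>

lemma cmod_add_power2: "(cmod (x + y))\<^sup>2 = (cmod x)\<^sup>2 + 2 * Re (cnj x * y) + (cmod y)\<^sup>2"
  unfolding cmod_power2 by (simp add: power2_eq_square algebra_simps)

text \<open>
  Equivalent to mean zero and variance \<open>v\<close> under a probability measure. Quantifying over the offset
  \<open>c\<close> replaces the mean, so that only nonnegative integrals occur and no integrability has to be
  carried along.
\<close>
definition centered :: "'a measure \<Rightarrow> ('a \<Rightarrow> complex) \<Rightarrow> real \<Rightarrow> bool" where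
  "centered M g v \<longleftrightarrow> g \<in> borel_measurable M \<and> 0 \<le> v \<and>
     (\<forall>c. (\<integral>\<^sup>+ \<omega>. ennreal ((cmod (c + g \<omega>))\<^sup>2) \<partial>M) = ennreal ((cmod c)\<^sup>2 + v))"

lemma centered_measurable: "centered M g v \<Longrightarrow> g \<in> borel_measurable M"
  by (simp add: centered_def)

lemma centered_nonneg: "centered M g v \<Longrightarrow> 0 \<le> v"
  by (simp add: centered_def)

lemma centered_nn_integral:
  "centered M g v \<Longrightarrow> (\<integral>\<^sup>+ \<omega>. ennreal ((cmod (c + g \<omega>))\<^sup>2) \<partial>M) = ennreal ((cmod c)\<^sup>2 + v)"
  by (simp add: centered_def)

lemma centered_distr:
  assumes "T \<in> measurable M N" "g \<in> borel_measurable N"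
  shows "centered (distr M N T) g v \<longleftrightarrow> centered M (\<lambda>\<omega>. g (T \<omega>)) v"
  using assms by (auto simp: centered_def nn_integral_distr)

text \<open>For \<open>s \<noteq> 0\<close> write \<open>c + s * g = s * (c / s + g)\<close> and use
  the offset \<open>c / s\<close>; the case \<open>s = 0\<close> is a constant.\<close>

lemma centered_mult:
  assumes "prob_space M" "centered M g v"
  shows "centered M (\<lambda>\<omega>. s * g \<omega>) ((cmod s)\<^sup>2 * v)"
proof -
  interpret prob_space M by fact
  note [measurable] = centered_measurable[OF assms(2)]
  show ?thesis
  proof (cases "s = 0")
    case True
    then show ?thesis by (simp add: centered_def emeasure_space_1)
  next
    case False
    have "(\<integral>\<^sup>+ \<omega>. ennreal ((cmod (c + s * g \<omega>))\<^sup>2) \<partial>M) = ennreal ((cmod c)\<^sup>2 + (cmod s)\<^sup>2 * v)" for c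
    proof -
      have "(\<integral>\<^sup>+ \<omega>. ennreal ((cmod (c + s * g \<omega>))\<^sup>2) \<partial>M)
          = (\<integral>\<^sup>+ \<omega>. ennreal ((cmod s)\<^sup>2) * ennreal ((cmod (c / s + g \<omega>))\<^sup>2) \<partial>M)"
      proof (rule nn_integral_cong)
        fix \<omega>
        have "c + s * g \<omega> = s * (c / s + g \<omega>)"
          using False by (simp add: field_simps)
        then show "ennreal ((cmod (c + s * g \<omega>))\<^sup>2) = ennreal ((cmod s)\<^sup>2) * ennreal ((cmod (c / s + g \<omega>))\<^sup>2)"
          by (simp only: norm_mult power_mult_distrib) (simp add: ennreal_mult)
      qed
      also have "\<dots> = ennreal ((cmod s)\<^sup>2) * ennreal ((cmod (c / s))\<^sup>2 + v)"
        by (subst nn_integral_cmult) (simp_all add: centered_nn_integral[OF assms(2)])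
      also have "\<dots> = ennreal ((cmod c)\<^sup>2 + (cmod s)\<^sup>2 * v)"
        using False centered_nonneg[OF assms(2)]
        by (simp add: ennreal_mult[symmetric] norm_divide power_divide distrib_left del: ennreal_plus)
      finally show ?thesis .
    qed
    then show ?thesis
      using centered_nonneg[OF assms(2)] by (simp add: centered_def)
  qed
qed

text \<open>Integrate over \<open>y\<close> first, with \<open>c + f x\<close> as the offset: this
  adds \<open>w\<close> pointwise in \<open>x\<close>, and no cross term ever appears.\<close>

lemma centered_pair:
  assumes "prob_space M" "prob_space N" "centered M f v" "centered N g w"
  shows "centered (M \<Otimes>\<^sub>M N) (\<lambda>(x, y). f x + g y) (v + w)"
proof -
  interpret M: prob_space M by fact
  interpret N: prob_space N by fact
  note [measurable] = centered_measurable[OF assms(3)] centered_measurable[OF assms(4)]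
  note nonneg = centered_nonneg[OF assms(3)] centered_nonneg[OF assms(4)]
  have "(\<integral>\<^sup>+ p. ennreal ((cmod (c + (\<lambda>(x, y). f x + g y) p))\<^sup>2) \<partial>(M \<Otimes>\<^sub>M N))
      = ennreal ((cmod c)\<^sup>2 + (v + w))" for c
  proof -
    have "(\<integral>\<^sup>+ p. ennreal ((cmod (c + (\<lambda>(x, y). f x + g y) p))\<^sup>2) \<partial>(M \<Otimes>\<^sub>M N))
        = (\<integral>\<^sup>+ x. \<integral>\<^sup>+ y. ennreal ((cmod ((c + f x) + g y))\<^sup>2) \<partial>N \<partial>M)"
      by (subst N.nn_integral_fst[symmetric]) (simp_all add: case_prod_unfold add.assoc)
    also have "\<dots> = (\<integral>\<^sup>+ x. ennreal ((cmod (c + f x))\<^sup>2) + ennreal w \<partial>M)"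
      using nonneg by (simp add: centered_nn_integral[OF assms(4)])
    also have "\<dots> = ennreal ((cmod c)\<^sup>2 + v) + ennreal w"
      by (subst nn_integral_add)
        (simp_all add: centered_nn_integral[OF assms(3)] M.emeasure_space_1)
    finally show ?thesis
      using nonneg by (simp add: ennreal_plus[symmetric] add.assoc del: ennreal_plus)
  qed
  then show ?thesis
    using nonneg by (simp add: centered_def)
qed

text \<open>Expanding the square leaves the cross term \<open>2 * Re (cnj c * g)\<close>, whose
  expectation vanishes because \<open>g\<close> has mean zero.\<close>

lemma centeredI:
  assumes "prob_space M" and g [measurable]: "g \<in> borel_measurable M"
    and "integrable M (\<lambda>\<omega>. (cmod (g \<omega>))\<^sup>2)" "(\<integral>\<omega>. (cmod (g \<omega>))\<^sup>2 \<partial>M) = v"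
    and "(\<integral>\<omega>. g \<omega> \<partial>M) = 0"
  shows "centered M g v"
proof -
  interpret prob_space M by fact
  have int: "integrable M g"
    using square_integrable_imp_integrable[of "\<lambda>\<omega>. cmod (g \<omega>)"] assms(3)
    by (simp add: integrable_norm_iff)
  have "(\<integral>\<^sup>+ \<omega>. ennreal ((cmod (c + g \<omega>))\<^sup>2) \<partial>M) = ennreal ((cmod c)\<^sup>2 + v)" for c
  proof (subst nn_integral_eq_integral)
    have *: "integrable M (\<lambda>\<omega>. Re (cnj c * g \<omega>))"
      by (intro integrable_Re integrable_mult_right int)
    show "integrable M (\<lambda>\<omega>. (cmod (c + g \<omega>))\<^sup>2)"
      unfolding cmod_add_power2
      by (intro Bochner_Integration.integrable_add integrable_mult_right * assms(3)) simp
    have "(\<integral>\<omega>. Re (cnj c * g \<omega>) \<partial>M) = 0"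
      using int assms(5) by (subst integral_Re) auto
    then have "(\<integral>\<omega>. (cmod (c + g \<omega>))\<^sup>2 \<partial>M) = (cmod c)\<^sup>2 + v"
      unfolding cmod_add_power2 using * assms(3,4) by (simp add: prob_space del: times_complex.sel)
    then show "ennreal (\<integral>\<omega>. (cmod (c + g \<omega>))\<^sup>2 \<partial>M) = ennreal ((cmod c)\<^sup>2 + v)"
      by simp
  qed simp
  moreover have "0 \<le> v"
    using assms(4) by (auto intro!: integral_nonneg_AE)
  ultimately show ?thesis by (simp add: centered_def)
qed

section \<open>Complex normal laws\<close>

lemma centered_std_normal: "centered std_normal_distribution complex_of_real 1"
proof (rule centeredI)
  show "prob_space std_normal_distribution"
    by (rule prob_space_normal_density) simp
  show "complex_of_real \<in> borel_measurable std_normal_distribution" by simp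
  show "integrable std_normal_distribution (\<lambda>a. (cmod (complex_of_real a))\<^sup>2)"
    using integrable_std_normal_distribution_moment[of 2] by simp
  show "(\<integral>a. (cmod (complex_of_real a))\<^sup>2 \<partial>std_normal_distribution) = 1"
    using std_normal_distribution_even_moments(1)[of 1] by simp
  show "(\<integral>a. complex_of_real a \<partial>std_normal_distribution) = 0"
    using integral_std_normal_distribution_moment_odd[of 1] by simp
qed

text \<open>\<open>a + i b\<close> with independent standard normal parts has variance 2, and
  scaling by \<open>sqrt (v / 2)\<close> makes it \<open>v\<close>. The point mass at
  \<open>v = 0\<close> is covered by the same computation.\<close>

lemma prob_space_complex_normal: "prob_space (complex_normal v)"
  and centered_complex_normal: "0 \<le> v \<Longrightarrow> centered (complex_normal v) (\<lambda>x. x) v"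
proof -
  interpret N: prob_space std_normal_distribution
    by (rule prob_space_normal_density) simp
  interpret NN: pair_prob_space std_normal_distribution std_normal_distribution ..
  have *: "(\<lambda>(a, b). complex_of_real (sqrt (v / 2)) * Complex a b)
      = (\<lambda>(a, b). complex_of_real (sqrt (v / 2)) * (complex_of_real a + \<i> * complex_of_real b))"
    by (simp add: Complex_eq)
  have m: "(\<lambda>(a, b). complex_of_real (sqrt (v / 2)) * Complex a b)
      \<in> borel_measurable (std_normal_distribution \<Otimes>\<^sub>M std_normal_distribution)"
    unfolding * by measurable
  show "prob_space (complex_normal v)"
    unfolding complex_normal_def by (intro NN.prob_space_distr m)
  assume "0 \<le> v"
  have "centered (std_normal_distribution \<Otimes>\<^sub>M std_normal_distribution)
      (\<lambda>(a, b). complex_of_real a + \<i> * complex_of_real b) 2"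
    using centered_pair[OF N.prob_space_axioms N.prob_space_axioms centered_std_normal
        centered_mult[OF N.prob_space_axioms centered_std_normal, of \<i>]] by simp
  from centered_mult[OF NN.prob_space_axioms this, of "complex_of_real (sqrt (v / 2))"] \<open>0 \<le> v\<close>
  show "centered (complex_normal v) (\<lambda>x. x) v"
    unfolding complex_normal_def by (subst centered_distr[OF m]) (simp_all add: Complex_eq case_prod_unfold)
qed

lemma complex_normal_vecD:
  assumes "complex_normal_vec \<mu> R"
  shows "prob_space \<mu>" "sets \<mu> = sets borel" "centered \<mu> (cinner c) (Re (cinner c (R *v c)))"
proof -
  show s [measurable_cong]: "sets \<mu> = sets borel"
    using assms by (simp add: complex_normal_vec_def)
  have m [measurable]: "cinner c \<in> borel_measurable \<mu>" for c
    by measurable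
  have d: "distr \<mu> borel (cinner c) = complex_normal (Re (cinner c (R *v c)))" for c
    using assms by (simp add: complex_normal_vec_def)
  \<comment> \<open>A push-forward has the same total mass, so it suffices that the law of one
    linear form is a probability measure.\<close>
  show "prob_space \<mu>"
    using prob_space_distrD[OF m] d prob_space_complex_normal by metis
  have "0 \<le> Re (cinner c (R *v c))"
    using assms by (simp add: complex_normal_vec_def psd_def)
  from centered_complex_normal[OF this]
  show "centered \<mu> (cinner c) (Re (cinner c (R *v c)))"
    unfolding d[symmetric] by (simp add: centered_distr)
qed

section \<open>Independence, and integration along a conditional distribution\<close>

lemma Int_stable_vimage: "Int_stable {X -` A \<inter> \<Omega> | A. A \<in> sets N}"
proof (rule Int_stableI)
  fix a b
  assume "a \<in> {X -` A \<inter> \<Omega> | A. A \<in> sets N}" "b \<in> {X -` A \<inter> \<Omega> | A. A \<in> sets N}"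
  then obtain A B where "a = X -` A \<inter> \<Omega>" "b = X -` B \<inter> \<Omega>" "A \<in> sets N" "B \<in> sets N"
    by blast
  then show "a \<inter> b \<in> {X -` A \<inter> \<Omega> | A. A \<in> sets N}"
    by (intro CollectI exI[of _ "A \<inter> B"]) auto
qed

lemma vimage_comp_sets_subset:
  assumes "f \<in> measurable N L"
    and "\<And>\<omega>. \<omega> \<in> \<Omega> \<Longrightarrow> X \<omega> \<in> space N"
  shows "{(\<lambda>\<omega>. f (X \<omega>)) -` A \<inter> \<Omega> | A. A \<in> sets L} \<subseteq> {X -` A \<inter> \<Omega> | A. A \<in> sets N}"
proof
  fix a
  assume "a \<in> {(\<lambda>\<omega>. f (X \<omega>)) -` A \<inter> \<Omega> | A. A \<in> sets L}"
  then obtain A where A: "a = (\<lambda>\<omega>. f (X \<omega>)) -` A \<inter> \<Omega>" "A \<in> sets L" by blast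
  have "a = X -` (f -` A \<inter> space N) \<inter> \<Omega>"
    using assms(2) unfolding A(1) by auto
  with measurable_sets[OF assms(1) A(2)] show "a \<in> {X -` A \<inter> \<Omega> | A. A \<in> sets N}"
    by blast
qed

text \<open>Events of \<open>f (X \<omega>)\<close> are events of \<open>X\<close>, likewise for
  \<open>g\<close> and \<open>Y\<close>. Once \<open>f\<close> and \<open>g\<close> take values in
  one common type, the library notion \<open>indep_var\<close> and its product law become
  available.\<close>

lemma indep_rv_indep_var:
  assumes "prob_space M" and ind: "indep_rv M X Y"
    and f: "f \<in> borel_measurable borel" and g: "g \<in> borel_measurable borel"
  shows "prob_space.indep_var M borel (\<lambda>\<omega>. f (X \<omega>)) borel (\<lambda>\<omega>. g (Y \<omega>))"
proof -
  interpret prob_space M by fact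
  note [measurable] = f g
  have [measurable]: "X \<in> borel_measurable M" "Y \<in> borel_measurable M"
    and XY: "indep_set {X -` A \<inter> space M | A. A \<in> sets borel} {Y -` B \<inter> space M | B. B \<in> sets borel}"
    using ind by (simp_all add: indep_rv_def)
  have X: "{(\<lambda>\<omega>. f (X \<omega>)) -` A \<inter> space M | A. A \<in> sets borel} \<subseteq> {X -` A \<inter> space M | A. A \<in> sets borel}"
    by (rule vimage_comp_sets_subset[OF f]) simp
  have Y: "{(\<lambda>\<omega>. g (Y \<omega>)) -` A \<inter> space M | A. A \<in> sets borel} \<subseteq> {Y -` A \<inter> space M | A. A \<in> sets borel}"
    by (rule vimage_comp_sets_subset[OF g]) simp
  have "indep_set {(\<lambda>\<omega>. f (X \<omega>)) -` A \<inter> space M | A. A \<in> sets borel}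
      {(\<lambda>\<omega>. g (Y \<omega>)) -` A \<inter> space M | A. A \<in> sets borel}"
    using X Y XY unfolding indep_set_def
    by (elim indep_sets_mono_sets) (simp split: bool.split)
  then show ?thesis
    unfolding indep_var_eq by (intro conjI indep_set_sigma_sets Int_stable_vimage) simp_all
qed

text \<open>The joint law is a product, so the value \<open>x\<close> of \<open>f\<close> can be
  frozen and used as the offset for \<open>g\<close>. The identity is between extended nonnegative
  values, and \<open>f\<close> may have any mean.\<close>

lemma nn_integral_indep_add_centered:
  assumes "prob_space M" and ind: "prob_space.indep_var M borel g borel f" and g: "centered M g w"
  shows "(\<integral>\<^sup>+ \<omega>. ennreal ((cmod (f \<omega> + g \<omega>))\<^sup>2) \<partial>M)
       = (\<integral>\<^sup>+ \<omega>. ennreal ((cmod (f \<omega>))\<^sup>2) \<partial>M) + ennreal w"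
proof -
  interpret prob_space M by fact
  have [measurable]: "f \<in> borel_measurable M" "g \<in> borel_measurable M"
    and d: "distr M borel g \<Otimes>\<^sub>M distr M borel f = distr M (borel \<Otimes>\<^sub>M borel) (\<lambda>\<omega>. (g \<omega>, f \<omega>))"
    using ind by (simp_all add: indep_var_distribution_eq)
  interpret F: prob_space "distr M borel f" by (rule prob_space_distr) simp
  interpret G: prob_space "distr M borel g" by (rule prob_space_distr) simp
  interpret FG: pair_prob_space "distr M borel g" "distr M borel f" ..
  have "(\<integral>\<^sup>+ \<omega>. ennreal ((cmod (f \<omega> + g \<omega>))\<^sup>2) \<partial>M)
      = (\<integral>\<^sup>+ p. ennreal ((cmod (snd p + fst p))\<^sup>2) \<partial>distr M (borel \<Otimes>\<^sub>M borel) (\<lambda>\<omega>. (g \<omega>, f \<omega>)))"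
    by (subst nn_integral_distr) auto
  also have "\<dots> = (\<integral>\<^sup>+ x. \<integral>\<^sup>+ y. ennreal ((cmod (x + y))\<^sup>2) \<partial>distr M borel g \<partial>distr M borel f)"
    unfolding d[symmetric] by (subst FG.nn_integral_snd[symmetric]) auto
  also have "\<dots> = (\<integral>\<^sup>+ x. \<integral>\<^sup>+ \<omega>. ennreal ((cmod (x + g \<omega>))\<^sup>2) \<partial>M \<partial>distr M borel f)"
    by (simp add: nn_integral_distr)
  also have "\<dots> = (\<integral>\<^sup>+ x. ennreal ((cmod x)\<^sup>2) + ennreal w \<partial>distr M borel f)"
    using centered_nonneg[OF g] by (simp add: centered_nn_integral[OF g])
  also have "\<dots> = (\<integral>\<^sup>+ \<omega>. ennreal ((cmod (f \<omega>))\<^sup>2) \<partial>M) + ennreal w"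
    using F.emeasure_space_1 by (subst nn_integral_add) (simp_all add: nn_integral_distr)
  finally show ?thesis .
qed

text \<open>Apply the preceding identity to \<open>c + f\<close> and \<open>g\<close>, for every
  offset \<open>c\<close>.\<close>

lemma centered_indep_add:
  assumes "prob_space M" and ind: "prob_space.indep_var M borel g borel f"
    and f: "centered M f v" and g: "centered M g w"
  shows "centered M (\<lambda>\<omega>. f \<omega> + g \<omega>) (v + w)"
proof -
  interpret prob_space M by fact
  note [measurable] = centered_measurable[OF f] centered_measurable[OF g]
  have "(\<integral>\<^sup>+ \<omega>. ennreal ((cmod (c + (f \<omega> + g \<omega>)))\<^sup>2) \<partial>M) = ennreal ((cmod c)\<^sup>2 + (v + w))" for c
  proof -
    have "indep_var borel ((\<lambda>x. x) \<circ> g) borel ((\<lambda>x. c + x) \<circ> f)"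
      by (rule indep_var_compose[OF ind]) auto
    then have "indep_var borel g borel (\<lambda>\<omega>. c + f \<omega>)" by (simp add: comp_def)
    from nn_integral_indep_add_centered[OF assms(1) this g] show ?thesis
      using centered_nonneg[OF f] centered_nonneg[OF g]
      by (simp add: centered_nn_integral[OF f] add.assoc ennreal_plus[symmetric] del: ennreal_plus)
  qed
  then show ?thesis
    using centered_nonneg[OF f] centered_nonneg[OF g] by (simp add: centered_def)
qed

text \<open>The definition prescribes the joint law of \<open>(Y, X)\<close> on rectangles only.
  These are stable under intersection and generate the product sigma-algebra, so the joint law is
  the law of \<open>Y\<close> bound to a kernel, and the integral can be iterated.\<close>

lemma regular_cond_distr_nn_integral:
  fixes X :: "'a \<Rightarrow> 'b::second_countable_topology" and Y :: "'a \<Rightarrow> 'c::second_countable_topology"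
  assumes "prob_space M" and rcd: "regular_cond_distr M X Y K"
    and [measurable]: "f \<in> borel_measurable (borel \<Otimes>\<^sub>M borel)"
  shows "(\<integral>\<^sup>+ \<omega>. f (Y \<omega>, X \<omega>) \<partial>M) = (\<integral>\<^sup>+ \<omega>. (\<integral>\<^sup>+ x. f (Y \<omega>, x) \<partial>K (Y \<omega>)) \<partial>M)"
proof -
  interpret prob_space M by fact
  have [measurable]: "X \<in> borel_measurable M" "Y \<in> borel_measurable M"
    and K': "K \<in> measurable borel (prob_algebra borel)"
    using rcd by (simp_all add: regular_cond_distr_def)
  have rect: "emeasure M {\<omega> \<in> space M. Y \<omega> \<in> A \<and> X \<omega> \<in> B}
      = (\<integral>\<^sup>+ \<omega>. indicator A (Y \<omega>) * emeasure (K (Y \<omega>)) B \<partial>M)"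
    if "A \<in> sets borel" "B \<in> sets borel" for A B
    using rcd that by (simp_all add: regular_cond_distr_def)
  have K [measurable]: "K \<in> measurable borel (subprob_algebra borel)"
    using K' by (rule measurable_prob_algebraD)
  have sK [measurable_cong]: "sets (K y) = sets borel" for y
    using K by (rule sets_kernel) simp
  \<comment> \<open>The kernel carries \<open>y\<close> along: \<open>N y\<close> is the law of
    \<open>(y, x)\<close> with \<open>x\<close> drawn from \<open>K y\<close>.\<close>
  define N where "N y = distr (K y) (borel \<Otimes>\<^sub>M borel) (\<lambda>x. (y, x))" for y
  have N: "N \<in> measurable borel (subprob_algebra (borel \<Otimes>\<^sub>M borel))"
    unfolding N_def by (rule measurable_distr2[OF _ K]) simp
  interpret D: finite_measure "distr M (borel \<Otimes>\<^sub>M borel) (\<lambda>\<omega>. (Y \<omega>, X \<omega>))"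
    by (rule finite_measure_distr) simp
  let ?D = "distr M (borel \<Otimes>\<^sub>M borel) (\<lambda>\<omega>. (Y \<omega>, X \<omega>))"
  have "?D = distr M borel Y \<bind> N"
  proof (rule measure_eqI_generator_eq[OF Int_stable_pair_measure_generator])
    show "sets ?D = sigma_sets UNIV {a \<times> b |a b. a \<in> sets borel \<and> b \<in> sets borel}"
      by (simp add: sets_pair_measure)
    show "sets (distr M borel Y \<bind> N) = sigma_sets UNIV {a \<times> b |a b. a \<in> sets borel \<and> b \<in> sets borel}"
      by (subst sets_bind[of _ _ "borel \<Otimes>\<^sub>M borel"])
        (simp_all add: N_def sets_pair_measure)
    fix Z :: "('c \<times> 'b) set"
    assume "Z \<in> {a \<times> b |a b. a \<in> sets borel \<and> b \<in> sets borel}"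
    then obtain A B where Z: "Z = A \<times> B" and [measurable]: "A \<in> sets borel" "B \<in> sets borel" by auto
    have *: "emeasure (N y) Z = indicator A y * emeasure (K y) B" for y
      unfolding N_def Z
      by (subst emeasure_distr) (auto simp: vimage_def sets_eq_imp_space_eq[OF sK] split: split_indicator)
    have "emeasure (distr M borel Y \<bind> N) Z = (\<integral>\<^sup>+ y. emeasure (N y) Z \<partial>distr M borel Y)"
      by (rule emeasure_bind) (use N in \<open>auto simp: Z\<close>)
    also have "\<dots> = (\<integral>\<^sup>+ \<omega>. indicator A (Y \<omega>) * emeasure (K (Y \<omega>)) B \<partial>M)"
      unfolding * by (subst nn_integral_distr) auto
    also have "\<dots> = emeasure M {\<omega> \<in> space M. Y \<omega> \<in> A \<and> X \<omega> \<in> B}"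
      by (rule rect[symmetric]) auto
    also have "\<dots> = emeasure ?D Z"
      unfolding Z by (subst emeasure_distr) (auto intro!: arg_cong[where f="emeasure M"])
    finally show "emeasure ?D Z = emeasure (distr M borel Y \<bind> N) Z" by simp
  next
    show "range (\<lambda>_::nat. UNIV :: ('c \<times> 'b) set) \<subseteq> {a \<times> b |a b. a \<in> sets borel \<and> b \<in> sets borel}"
      by (auto intro!: exI[of _ UNIV])
    show "emeasure ?D UNIV \<noteq> \<infinity>" for i :: nat
      using D.emeasure_finite by simp
  qed auto
  have "(\<integral>\<^sup>+ \<omega>. f (Y \<omega>, X \<omega>) \<partial>M) = (\<integral>\<^sup>+ p. f p \<partial>?D)"
    by (subst nn_integral_distr) auto
  also have "\<dots> = (\<integral>\<^sup>+ y. \<integral>\<^sup>+ p. f p \<partial>N y \<partial>distr M borel Y)"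
    unfolding \<open>?D = _\<close> by (rule nn_integral_bind) (use N in auto)
  also have "\<dots> = (\<integral>\<^sup>+ \<omega>. \<integral>\<^sup>+ p. f p \<partial>N (Y \<omega>) \<partial>M)"
    using N by (intro nn_integral_distr nn_integral_measurable_subprob_algebra2) auto
  also have "\<dots> = (\<integral>\<^sup>+ \<omega>. (\<integral>\<^sup>+ x. f (Y \<omega>, x) \<partial>K (Y \<omega>)) \<partial>M)"
    unfolding N_def by (intro nn_integral_cong nn_integral_distr) auto
  finally show ?thesis .
qed

section \<open>Second-moment matrices determined by their quadratic forms\<close>

lemma bounded_linear_cinner_matrix: "bounded_linear (\<lambda>G :: complex^'n^'m. cinner c (G *v x))"
  unfolding linear_conv_bounded_linear[symmetric]
  by (rule linearI)
    (simp_all add: cinner_def matrix_vector_mult_def distrib_left distrib_right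
       sum.distrib scaleR_sum_right[symmetric])

lemma borel_measurable_outer [measurable]:
  fixes f :: "'a \<Rightarrow> complex^'n"
  assumes [measurable]: "f \<in> borel_measurable M"
  shows "(\<lambda>\<omega>. outer (f \<omega>) (f \<omega>)) \<in> borel_measurable M"
proof -
  have "continuous_on UNIV (\<lambda>x :: complex^'n. outer x x)"
    unfolding outer_def by (intro continuous_intros)
  then show ?thesis
    using assms by (rule borel_measurable_continuous_on)
qed

text \<open>The norm on nested vectors is the Frobenius norm, which is multiplicative on rank-one
  matrices. Hence integrability of \<open>x x^H\<close> amounts to square integrability of
  \<open>x\<close>.\<close>

lemma norm_outer: "norm (outer x x) = (norm x)\<^sup>2"
proof -
  have "(norm (outer x x $ i))\<^sup>2 = (cmod (x $ i))\<^sup>2 * (norm x)\<^sup>2" for i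
    by (simp add: norm_vec_power2 outer_def norm_mult power_mult_distrib sum_distrib_left)
  then have "(norm (outer x x))\<^sup>2 = ((norm x)\<^sup>2)\<^sup>2"
    by (simp only: norm_vec_power2[of "outer x x"] sum_distrib_right[symmetric]
        norm_vec_power2[of x, symmetric] power2_eq_square[of "(norm x)\<^sup>2"])
  then show ?thesis by (simp only: power2_eq_iff_nonneg norm_ge_zero zero_le_power2)
qed

lemma integrable_outer_iff:
  assumes [measurable]: "f \<in> borel_measurable M"
  shows "integrable M (\<lambda>\<omega>. outer (f \<omega>) (f \<omega>)) \<longleftrightarrow> integrable M (\<lambda>\<omega>. (norm (f \<omega>))\<^sup>2)"
  by (subst integrable_norm_iff[symmetric]) (auto simp: norm_outer)

lemma ctranspose_ctranspose: "ctranspose (ctranspose A) = A"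
  by (simp add: ctranspose_def vec_eq_iff)

lemma ctranspose_add: "ctranspose (A + B) = ctranspose A + ctranspose B"
  by (simp add: ctranspose_def vec_eq_iff)

lemma ctranspose_diff: "ctranspose (A - B) = ctranspose A - ctranspose B"
  by (simp add: ctranspose_def vec_eq_iff)

lemma ctranspose_scaleR: "ctranspose (a *\<^sub>R A) = a *\<^sub>R ctranspose A"
  by (simp add: ctranspose_def vec_eq_iff)

lemma ctranspose_mul: "ctranspose (A ** B) = ctranspose B ** ctranspose A"
  by (simp add: ctranspose_def vec_eq_iff matrix_matrix_mult_def mult.commute)

lemma ctranspose_mat: "ctranspose (mat a) = mat (cnj a)"
  by (simp add: ctranspose_def vec_eq_iff mat_def)

text \<open>Let \<open>E\<close> be the difference and \<open>y = E c\<close>. Evaluating its form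
  at \<open>c + y\<close> leaves twice the squared norm of \<open>y\<close>, since
  \<open>c^H E y = y^H y\<close> for Hermitian \<open>E\<close>; so \<open>y = 0\<close>.\<close>

lemma hermitian_eqI:
  assumes "ctranspose G = G" "ctranspose H = H"
    and eq: "\<And>c. Re (cinner c (G *v c)) = Re (cinner c (H *v c))"
  shows "G = H"
proof -
  define E where "E = G - H"
  have herm: "ctranspose E = E"
    using assms(1,2) by (simp add: E_def ctranspose_diff)
  have zero: "Re (cinner c (E *v c)) = 0" for c
    using eq[of c] cinner_add_right[of c "E *v c" "H *v c"]
    by (simp add: E_def matrix_vector_mult_diff_rdistrib)
  have "E *v c = 0" for c
  proof -
    let ?y = "E *v c"
    have "cinner (c + ?y) (E *v (c + ?y))
        = cinner c (E *v c) + cinner c (E *v ?y) + cinner ?y ?y + cinner ?y (E *v ?y)"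
      by (simp add: cinner_add_left cinner_add_right vec.add)
    moreover have "cinner c (E *v ?y) = cinner ?y ?y"
      by (simp add: cinner_matrix_vector_mult[of c] herm)
    ultimately have "2 * Re (cinner ?y ?y) = 0"
      using zero[of "c + ?y"] zero[of c] zero[of ?y] by simp
    then show ?thesis by (simp add: cinner_same)
  qed
  then have "E = 0"
    by (subst matrix_eq) simp
  then show ?thesis by (simp add: E_def)
qed

lemma ctranspose_integral_outer:
  assumes int: "integrable M (\<lambda>\<omega>. outer (f \<omega>) (f \<omega>))"
  shows "ctranspose (\<integral>\<omega>. outer (f \<omega>) (f \<omega>) \<partial>M) = (\<integral>\<omega>. outer (f \<omega>) (f \<omega>) \<partial>M)"
proof -
  have "bounded_linear (ctranspose :: complex^'b^'b \<Rightarrow> _)"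
    unfolding linear_conv_bounded_linear[symmetric]
    by (rule linearI) (simp_all add: ctranspose_add ctranspose_scaleR)
  from integral_bounded_linear[OF this int] show ?thesis
    by (simp add: ctranspose_def outer_def mult.commute)
qed

text \<open>Unit vectors give the second moments of the coordinates, hence square integrability and
  the trace formula; \<open>hermitian_eqI\<close> then identifies the matrix. Since
  \<open>ennreal\<close> sends negative reals to 0, nonnegativity of the form is what allows real
  values to be recovered from \<open>q\<close>.\<close>

lemma integral_outer_eqI:
  fixes f :: "'a \<Rightarrow> complex^'n"
  assumes f [measurable]: "f \<in> borel_measurable M" and P: "ctranspose P = P"
    and q: "\<And>c. (\<integral>\<^sup>+ \<omega>. ennreal ((cmod (cinner c (f \<omega>)))\<^sup>2) \<partial>M) = ennreal (Re (cinner c (P *v c)))"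
    and nonneg: "\<And>c. 0 \<le> Re (cinner c (P *v c))"
  shows "integrable M (\<lambda>\<omega>. outer (f \<omega>) (f \<omega>))" "(\<integral>\<omega>. outer (f \<omega>) (f \<omega>) \<partial>M) = P"
    "integrable M (\<lambda>\<omega>. (norm (f \<omega>))\<^sup>2)" "(\<integral>\<omega>. (norm (f \<omega>))\<^sup>2 \<partial>M) = Re (trace P)"
proof -
  have b: "integrable M (\<lambda>\<omega>. (cmod (cinner c (f \<omega>)))\<^sup>2)"
    "(\<integral>\<omega>. (cmod (cinner c (f \<omega>)))\<^sup>2 \<partial>M) = Re (cinner c (P *v c))" for c
    using q[of c] nonneg[of c] by (simp_all add: nn_integral_eq_integrable)
  have b': "integrable M (\<lambda>\<omega>. (cmod (f \<omega> $ i))\<^sup>2)" "(\<integral>\<omega>. (cmod (f \<omega> $ i))\<^sup>2 \<partial>M) = Re (P $ i $ i)" for i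
    using b[of "axis i 1"] by (simp_all add: cinner_axis matrix_vector_mult_axis_nth)
  show i: "integrable M (\<lambda>\<omega>. (norm (f \<omega>))\<^sup>2)"
    unfolding norm_vec_power2 by (intro Bochner_Integration.integrable_sum b')
  show "(\<integral>\<omega>. (norm (f \<omega>))\<^sup>2 \<partial>M) = Re (trace P)"
    unfolding norm_vec_power2 by (subst Bochner_Integration.integral_sum) (simp_all add: b' trace_def)
  show io: "integrable M (\<lambda>\<omega>. outer (f \<omega>) (f \<omega>))"
    using i by (simp add: integrable_outer_iff)
  show "(\<integral>\<omega>. outer (f \<omega>) (f \<omega>) \<partial>M) = P"
  proof (rule hermitian_eqI[OF ctranspose_integral_outer[OF io] P])
    fix c
    have "cinner c ((\<integral>\<omega>. outer (f \<omega>) (f \<omega>) \<partial>M) *v c)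
        = (\<integral>\<omega>. complex_of_real ((cmod (cinner c (f \<omega>)))\<^sup>2) \<partial>M)"
      using integral_bounded_linear[OF bounded_linear_cinner_matrix io, of c c]
      by (simp add: cinner_outer)
    then show "Re (cinner c ((\<integral>\<omega>. outer (f \<omega>) (f \<omega>) \<partial>M) *v c)) = Re (cinner c (P *v c))"
      by (simp add: b del: of_real_power)
  qed
qed

lemma zero_mean_with_cov_centered:
  assumes "prob_space M" "zero_mean_with_cov M X S"
  shows "centered M (\<lambda>\<omega>. cinner c (X \<omega>)) (Re (cinner c (S *v c)))"
proof (rule centeredI[OF assms(1)])
  interpret prob_space M by fact
  have X [measurable]: "X \<in> borel_measurable M" and X2: "integrable M (\<lambda>\<omega>. (norm (X \<omega>))\<^sup>2)"
    and mean: "(\<integral>\<omega>. X \<omega> \<partial>M) = 0" and cov: "(\<integral>\<omega>. outer (X \<omega>) (X \<omega>) \<partial>M) = S"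
    using assms(2) by (simp_all add: zero_mean_with_cov_def)
  have o: "integrable M (\<lambda>\<omega>. outer (X \<omega>) (X \<omega>))"
    using X2 by (simp add: integrable_outer_iff)
  show "(\<lambda>\<omega>. cinner c (X \<omega>)) \<in> borel_measurable M" by measurable
  have *: "integrable M (\<lambda>\<omega>. complex_of_real ((cmod (cinner c (X \<omega>)))\<^sup>2))"
    "(\<integral>\<omega>. complex_of_real ((cmod (cinner c (X \<omega>)))\<^sup>2) \<partial>M) = cinner c (S *v c)"
    using integrable_bounded_linear[OF bounded_linear_cinner_matrix o, of c c]
      integral_bounded_linear[OF bounded_linear_cinner_matrix o, of c c]
    by (simp_all add: cinner_outer cov)
  show "integrable M (\<lambda>\<omega>. (cmod (cinner c (X \<omega>)))\<^sup>2)"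
    using integrable_Re[OF *(1)] by (simp del: of_real_power)
  show "(\<integral>\<omega>. (cmod (cinner c (X \<omega>)))\<^sup>2 \<partial>M) = Re (cinner c (S *v c))"
    using *(2) by (metis Re_complex_of_real integral_complex_of_real)
  \<comment> \<open>A linear form may be moved through the integral of \<open>X\<close> only if
    \<open>X\<close> is integrable; on a probability space this follows from square
    integrability.\<close>
  have "integrable M X"
    using square_integrable_imp_integrable[of "\<lambda>\<omega>. norm (X \<omega>)"] X2
    by (simp add: integrable_norm_iff)
  moreover have "bounded_linear (cinner c)"
    unfolding linear_conv_bounded_linear[symmetric]
    by (rule linearI) (simp_all add: cinner_add_right cinner_scaleR_right)
  ultimately show "(\<integral>\<omega>. cinner c (X \<omega>) \<partial>M) = 0"
    using mean integral_bounded_linear[of "cinner c" M X] by (simp add: cinner_def)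
qed

section \<open>Second moments of the observation\<close>

lemma mat_mult_vector: "mat a *v x = a *s x"
proof -
  have "(\<Sum>j\<in>UNIV. (if i = j then a else 0) * x $ j) = (\<Sum>j\<in>UNIV. if i = j then a * x $ j else 0)" for i
    by (rule sum.cong) auto
  then show ?thesis
    by (simp add: vec_eq_iff matrix_vector_mult_def mat_def)
qed

lemma scaleR_matrix_vector: "(a *\<^sub>R A) *v x = a *\<^sub>R (A *v (x :: complex^'n))"
  by (simp add: vec_eq_iff matrix_vector_mult_def scaleR_sum_right)

lemma cinner_diag_mat: "cinner u (diag_mat x *v u) = (\<Sum>i\<in>UNIV. x $ i * complex_of_real ((cmod (u $ i))\<^sup>2))"
proof -
  have "(\<Sum>j\<in>UNIV. (if i = j then x $ i else 0) * u $ j) = (\<Sum>j\<in>UNIV. if i = j then x $ i * u $ j else 0)" for i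
    by (rule sum.cong) auto
  then have "diag_mat x *v u = (\<chi> i. x $ i * u $ i)"
    by (simp add: vec_eq_iff matrix_vector_mult_def diag_mat_def)
  then show ?thesis
    by (simp add: cinner_def complex_norm_square mult_ac del: of_real_power)
qed

text \<open>The diagonal entries are values of the form of \<open>R\<close> at unit vectors, so
  their real parts are nonnegative weights for the squared moduli of the
  \<open>u $ i\<close>.\<close>

lemma diag_mat_diagonal_nonneg:
  assumes "\<And>c. 0 \<le> Re (cinner c (R *v c))"
  shows "0 \<le> Re (cinner u (diag_mat (\<chi> i. R $ i $ i) *v u))"
proof -
  have "0 \<le> Re (R $ i $ i)" for i
    using assms[of "axis i 1"] by (simp add: cinner_axis matrix_vector_mult_axis_nth)
  then show ?thesis
    by (auto simp: cinner_diag_mat simp del: of_real_power intro!: sum_nonneg)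
qed

lemma centered_integral:
  assumes "centered M g v"
  shows "integrable M (\<lambda>\<omega>. (cmod (g \<omega>))\<^sup>2)" "(\<integral>\<omega>. (cmod (g \<omega>))\<^sup>2 \<partial>M) = v"
  using centered_nn_integral[OF assms, of 0] centered_measurable[OF assms] centered_nonneg[OF assms]
  by (simp_all add: nn_integral_eq_integrable)

lemma complex_normal_rv_centered:
  assumes "complex_normal_rv M X R"
  shows "centered M (\<lambda>\<omega>. cinner c (X \<omega>)) (Re (cinner c (R *v c)))"
  using assms complex_normal_vecD(3)[of "distr M borel X" R c]
  by (simp add: complex_normal_rv_def centered_distr)

text \<open>Given \<open>h = x\<close>, the pair of distortions has a product law, so
  \<open>centered_pair\<close> applies with the offset \<open>c^H x\<close>. The result is a
  combination of terms \<open>|a^H x|^2\<close> with nonnegative weights, and each of them averages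
  to \<open>a^H R a\<close>.\<close>

lemma signal_second_moment:
  fixes h \<eta>\<^sub>r :: "'a \<Rightarrow> complex^'n" and \<eta>\<^sub>t :: "'a \<Rightarrow> complex"
  assumes "prob_space M" and h: "complex_normal_rv M h R" and "0 \<le> v" "0 \<le> \<kappa>"
    and K: "\<And>x. complex_normal_vec (K x) (\<kappa> *\<^sub>R diag_mat (\<chi> i. complex_of_real ((cmod (x $ i))\<^sup>2)))"
    and rcd: "regular_cond_distr M (\<lambda>\<omega>. (\<eta>\<^sub>t \<omega>, \<eta>\<^sub>r \<omega>)) h (\<lambda>x. complex_normal v \<Otimes>\<^sub>M K x)"
  shows "(\<integral>\<^sup>+ \<omega>. ennreal ((cmod ((d + \<eta>\<^sub>t \<omega>) * cinner u (h \<omega>) + cinner u (\<eta>\<^sub>r \<omega>) + cinner w (h \<omega>)))\<^sup>2) \<partial>M)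
    = ennreal (Re (cinner (cnj d *s u + w) (R *v (cnj d *s u + w))) + v * Re (cinner u (R *v u))
        + \<kappa> * Re (cinner u (diag_mat (\<chi> i. R $ i $ i) *v u)))"
proof -
  interpret prob_space M by fact
  \<comment> \<open>The form is conjugate-linear on the left, so \<open>d * u^H x\<close> is the
    form with left argument \<open>cnj d *s u\<close>.\<close>
  define c where "c = cnj d *s u + w"
  have split: "(d + a) * cinner u x + cinner u b + cinner w x = cinner c x + (cinner u x * a + cinner u b)" for a x b
    by (simp add: c_def cinner_add_left cinner_scale_left algebra_simps)
  note hc = complex_normal_rv_centered[OF h]
  have "(\<lambda>(x, a, b). ennreal ((cmod (cinner c x + (cinner u x * a + cinner u b)))\<^sup>2))
      \<in> borel_measurable (borel \<Otimes>\<^sub>M (borel \<Otimes>\<^sub>M borel))"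
    by measurable
  then have "(\<lambda>(x, a, b). ennreal ((cmod (cinner c x + (cinner u x * a + cinner u b)))\<^sup>2))
      \<in> borel_measurable (borel \<Otimes>\<^sub>M borel)"
    by (simp only: borel_prod)
  note rcd' = regular_cond_distr_nn_integral[OF \<open>prob_space M\<close> rcd this, unfolded prod.case]
  \<comment> \<open>The coordinate \<open>x $ i\<close> is written as
    \<open>cinner (axis i 1) x\<close>, so that all three terms are squared moduli of linear forms
    and average over \<open>h\<close> in the same way.\<close>
  have inner: "(\<integral>\<^sup>+ y. (case y of (a, b) \<Rightarrow> ennreal ((cmod (cinner c x + (cinner u x * a + cinner u b)))\<^sup>2))
        \<partial>(complex_normal v \<Otimes>\<^sub>M K x))
      = ennreal ((cmod (cinner c x))\<^sup>2 + v * (cmod (cinner u x))\<^sup>2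
          + \<kappa> * (\<Sum>i\<in>UNIV. (cmod (u $ i))\<^sup>2 * (cmod (cinner (axis i 1) x))\<^sup>2))" for x
  proof -
    have "Re (cinner u ((\<kappa> *\<^sub>R diag_mat (\<chi> i. complex_of_real ((cmod (x $ i))\<^sup>2))) *v u))
        = \<kappa> * (\<Sum>i\<in>UNIV. (cmod (u $ i))\<^sup>2 * (cmod (cinner (axis i 1) x))\<^sup>2)"
      by (simp add: scaleR_matrix_vector cinner_scaleR_right cinner_diag_mat cinner_axis mult.commute
          flip: of_real_power of_real_mult)
    with complex_normal_vecD(1,3)[OF K[of x]]
    have "centered (K x) (cinner u) (\<kappa> * (\<Sum>i\<in>UNIV. (cmod (u $ i))\<^sup>2 * (cmod (cinner (axis i 1) x))\<^sup>2))"
      by metis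
    from centered_pair[OF prob_space_complex_normal complex_normal_vecD(1)[OF K[of x]]
        centered_mult[OF prob_space_complex_normal centered_complex_normal[OF \<open>0 \<le> v\<close>], of "cinner u x"] this]
    have "centered (complex_normal v \<Otimes>\<^sub>M K x) (\<lambda>(a, b). cinner u x * a + cinner u b)
        ((cmod (cinner u x))\<^sup>2 * v + \<kappa> * (\<Sum>i\<in>UNIV. (cmod (u $ i))\<^sup>2 * (cmod (cinner (axis i 1) x))\<^sup>2))" .
    from centered_nn_integral[OF this, of "cinner c x"] show ?thesis
      by (simp add: case_prod_unfold add.assoc mult.commute)
  qed
  have "(\<integral>\<^sup>+ \<omega>. ennreal ((cmod (cinner c (h \<omega>) + (cinner u (h \<omega>) * \<eta>\<^sub>t \<omega> + cinner u (\<eta>\<^sub>r \<omega>))))\<^sup>2) \<partial>M)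
      = (\<integral>\<^sup>+ \<omega>. ennreal ((cmod (cinner c (h \<omega>)))\<^sup>2 + v * (cmod (cinner u (h \<omega>)))\<^sup>2
          + \<kappa> * (\<Sum>i\<in>UNIV. (cmod (u $ i))\<^sup>2 * (cmod (cinner (axis i 1) (h \<omega>)))\<^sup>2)) \<partial>M)"
    unfolding rcd' inner ..
  also have "\<dots> = ennreal (\<integral>\<omega>. (cmod (cinner c (h \<omega>)))\<^sup>2 + v * (cmod (cinner u (h \<omega>)))\<^sup>2
          + \<kappa> * (\<Sum>i\<in>UNIV. (cmod (u $ i))\<^sup>2 * (cmod (cinner (axis i 1) (h \<omega>)))\<^sup>2) \<partial>M)"
    using assms(3,4) centered_integral[OF hc]
    by (intro nn_integral_eq_integral) (auto intro!: sum_nonneg add_nonneg_nonneg mult_nonneg_nonneg)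
  also have "(\<integral>\<omega>. (cmod (cinner c (h \<omega>)))\<^sup>2 + v * (cmod (cinner u (h \<omega>)))\<^sup>2
          + \<kappa> * (\<Sum>i\<in>UNIV. (cmod (u $ i))\<^sup>2 * (cmod (cinner (axis i 1) (h \<omega>)))\<^sup>2) \<partial>M)
      = Re (cinner c (R *v c)) + v * Re (cinner u (R *v u))
        + \<kappa> * (\<Sum>i\<in>UNIV. (cmod (u $ i))\<^sup>2 * Re (cinner (axis i 1) (R *v axis i 1)))"
    using centered_integral[OF hc] by simp
  also have "(\<Sum>i\<in>UNIV. (cmod (u $ i))\<^sup>2 * Re (cinner (axis i 1) (R *v axis i 1)))
      = Re (cinner u (diag_mat (\<chi> i. R $ i $ i) *v u))"
    by (simp add: cinner_diag_mat cinner_axis matrix_vector_mult_axis_nth mult.commute del: of_real_power)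
  finally show ?thesis
    unfolding split c_def .
qed

text \<open>\<open>\<nu>\<close> is independent of the triple on which the signal depends, so it
  only adds its variance. The vector \<open>w\<close> serves two purposes: \<open>w = 0\<close>
  gives the second moments of the observation, and \<open>w = - c\<close> those of an estimation
  error.\<close>

lemma observation_second_moment:
  fixes h \<eta>\<^sub>r \<nu> :: "'a \<Rightarrow> complex^'n" and \<eta>\<^sub>t :: "'a \<Rightarrow> complex"
  assumes "prob_space M" and h: "complex_normal_rv M h R" and v: "0 \<le> v" "0 \<le> \<kappa>"
    and K: "\<And>x. complex_normal_vec (K x) (\<kappa> *\<^sub>R diag_mat (\<chi> i. complex_of_real ((cmod (x $ i))\<^sup>2)))"
    and rcd: "regular_cond_distr M (\<lambda>\<omega>. (\<eta>\<^sub>t \<omega>, \<eta>\<^sub>r \<omega>)) h (\<lambda>x. complex_normal v \<Otimes>\<^sub>M K x)"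
    and \<nu>: "\<And>c. centered M (\<lambda>\<omega>. cinner c (\<nu> \<omega>)) (Re (cinner c (N *v c)))"
    and ind: "indep_rv M \<nu> (\<lambda>\<omega>. (h \<omega>, \<eta>\<^sub>t \<omega>, \<eta>\<^sub>r \<omega>))"
  shows "(\<integral>\<^sup>+ \<omega>. ennreal ((cmod (cinner u ((d + \<eta>\<^sub>t \<omega>) *s h \<omega> + \<eta>\<^sub>r \<omega> + \<nu> \<omega>) + cinner w (h \<omega>)))\<^sup>2) \<partial>M)
    = ennreal (Re (cinner (cnj d *s u + w) (R *v (cnj d *s u + w)))
        + Re (cinner u ((v *\<^sub>R R + \<kappa> *\<^sub>R diag_mat (\<chi> i. R $ i $ i) + N) *v u)))"
    and "0 \<le> Re (cinner (cnj d *s u + w) (R *v (cnj d *s u + w)))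
        + Re (cinner u ((v *\<^sub>R R + \<kappa> *\<^sub>R diag_mat (\<chi> i. R $ i $ i) + N) *v u))"
proof -
  interpret prob_space M by fact
  define f where "f = (\<lambda>(x, a, b). (d + a) * cinner u x + cinner u b + cinner w x)"
  have "f \<in> borel_measurable (borel \<Otimes>\<^sub>M (borel \<Otimes>\<^sub>M borel))"
    unfolding f_def by measurable
  then have f: "f \<in> borel_measurable borel"
    by (simp only: borel_prod)
  have W: "Re (cinner u ((v *\<^sub>R R + \<kappa> *\<^sub>R diag_mat (\<chi> i. R $ i $ i) + N) *v u))
      = v * Re (cinner u (R *v u)) + \<kappa> * Re (cinner u (diag_mat (\<chi> i. R $ i $ i) *v u))
        + Re (cinner u (N *v u))"
    by (simp add: matrix_vector_mult_add_rdistrib cinner_add_right scaleR_matrix_vector cinner_scaleR_right)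
  have psd: "0 \<le> Re (cinner c (R *v c))" for c
    using centered_nonneg[OF complex_normal_rv_centered[OF h]] .
  have "0 \<le> Re (cinner u (diag_mat (\<chi> i. R $ i $ i) *v u))"
    using psd by (rule diag_mat_diagonal_nonneg)
  note nonneg = psd[of "cnj d *s u + w"] mult_nonneg_nonneg[OF v(1) psd[of u]]
    mult_nonneg_nonneg[OF v(2) this] centered_nonneg[OF \<nu>[of u]]
  show "0 \<le> Re (cinner (cnj d *s u + w) (R *v (cnj d *s u + w)))
        + Re (cinner u ((v *\<^sub>R R + \<kappa> *\<^sub>R diag_mat (\<chi> i. R $ i $ i) + N) *v u))"
    unfolding W using nonneg by linarith
  have "cinner u ((d + \<eta>\<^sub>t \<omega>) *s h \<omega> + \<eta>\<^sub>r \<omega> + \<nu> \<omega>) + cinner w (h \<omega>)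
      = f (h \<omega>, \<eta>\<^sub>t \<omega>, \<eta>\<^sub>r \<omega>) + cinner u (\<nu> \<omega>)" for \<omega>
    by (simp add: f_def cinner_add_right cinner_scale_right distrib_right)
  then have "(\<integral>\<^sup>+ \<omega>. ennreal ((cmod (cinner u ((d + \<eta>\<^sub>t \<omega>) *s h \<omega> + \<eta>\<^sub>r \<omega> + \<nu> \<omega>) + cinner w (h \<omega>)))\<^sup>2) \<partial>M)
      = (\<integral>\<^sup>+ \<omega>. ennreal ((cmod (f (h \<omega>, \<eta>\<^sub>t \<omega>, \<eta>\<^sub>r \<omega>)))\<^sup>2) \<partial>M) + ennreal (Re (cinner u (N *v u)))"
    using nn_integral_indep_add_centered[OF \<open>prob_space M\<close>
        indep_rv_indep_var[OF \<open>prob_space M\<close> ind borel_measurable_cinner f] \<nu>] by simp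
  also have "\<dots> = ennreal (Re (cinner (cnj d *s u + w) (R *v (cnj d *s u + w))) + v * Re (cinner u (R *v u))
        + \<kappa> * Re (cinner u (diag_mat (\<chi> i. R $ i $ i) *v u))) + ennreal (Re (cinner u (N *v u)))"
    using signal_second_moment[OF \<open>prob_space M\<close> h v K rcd, of d u w] by (simp add: f_def)
  also have "\<dots> = ennreal (Re (cinner (cnj d *s u + w) (R *v (cnj d *s u + w)))
        + Re (cinner u ((v *\<^sub>R R + \<kappa> *\<^sub>R diag_mat (\<chi> i. R $ i $ i) + N) *v u)))"
    unfolding W using nonneg by (subst ennreal_plus[symmetric]) (auto simp: add.assoc)
  finally show "(\<integral>\<^sup>+ \<omega>. ennreal ((cmod (cinner u ((d + \<eta>\<^sub>t \<omega>) *s h \<omega> + \<eta>\<^sub>r \<omega> + \<nu> \<omega>) + cinner w (h \<omega>)))\<^sup>2) \<partial>M)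
    = ennreal (Re (cinner (cnj d *s u + w) (R *v (cnj d *s u + w)))
        + Re (cinner u ((v *\<^sub>R R + \<kappa> *\<^sub>R diag_mat (\<chi> i. R $ i $ i) + N) *v u)))" .
qed

section \<open>Positive definite matrices and completing the square\<close>

lemma matrix_inv_right:
  assumes "invertible Z"
  shows "Z ** matrix_inv Z = mat 1"
proof -
  have "\<exists>W. Z ** W = mat 1 \<and> W ** Z = mat 1"
    using assms by (simp add: invertible_def)
  from someI_ex[OF this] show ?thesis
    by (simp add: matrix_inv_def)
qed

text \<open>A nonzero kernel vector would have form value 0, and a square matrix with trivial kernel
  is invertible.\<close>

lemma invertible_if_pos_def:
  fixes Z :: "complex^'n^'n"
  assumes "\<And>c. c \<noteq> 0 \<Longrightarrow> 0 < Re (cinner c (Z *v c))"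
  shows "invertible Z"
proof -
  have "x = 0" if "Z *v x = 0" for x
    using assms[of x] that by (cases "x = 0") (auto simp: cinner_def)
  then show ?thesis
    unfolding invertible_left_inverse matrix_left_invertible_ker by blast
qed

text \<open>The adjoint of \<open>Z ** matrix_inv Z = mat 1\<close> exhibits a left inverse of
  \<open>Z\<close>, which must agree with the right inverse.\<close>

lemma ctranspose_matrix_inv:
  assumes "ctranspose Z = Z" "invertible Z"
  shows "ctranspose (matrix_inv Z) = matrix_inv Z"
proof -
  have "ctranspose (matrix_inv Z) ** Z = mat 1"
    using arg_cong[OF matrix_inv_right[OF assms(2)], of ctranspose] assms(1)
    by (simp add: ctranspose_mul ctranspose_mat)
  then have "ctranspose (matrix_inv Z) ** (Z ** matrix_inv Z) = matrix_inv Z"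
    by (simp add: matrix_mul_assoc)
  then show ?thesis
    using matrix_inv_right[OF assms(2)] by simp
qed

text \<open>A Hermitian matrix has a real diagonal. This reconciles the real mean square error with
  the complex trace.\<close>

lemma of_real_Re_trace:
  assumes "ctranspose P = P"
  shows "complex_of_real (Re (trace P)) = trace P"
proof -
  have "cnj (P $ i $ i) = P $ i $ i" for i
    using arg_cong[OF assms, of "\<lambda>Q. Q $ i $ i"] by (simp add: ctranspose_def)
  then have "cnj (trace P) = trace P"
    by (simp add: trace_def)
  then show ?thesis
    by (metis Reals_cnj_iff complex_is_Real_iff complex_eq_iff Re_complex_of_real Im_complex_of_real)
qed

lemma cinner_congruence:
  "cinner c ((D ** Z ** ctranspose D) *v c) = cinner (ctranspose D *v c) (Z *v (ctranspose D *v c))"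
  by (simp add: matrix_vector_mul_assoc[symmetric] cinner_matrix_vector_mult[of c D])

lemma Re_trace_congruence:
  "Re (trace (D ** Z ** ctranspose D))
    = (\<Sum>i\<in>UNIV. Re (cinner (ctranspose D *v axis i 1) (Z *v (ctranspose D *v axis i 1))))"
  unfolding cinner_congruence[symmetric]
  by (simp add: cinner_axis matrix_vector_mult_axis_nth trace_def)

text \<open>The trace is the sum of the values of the form of \<open>Z\<close> at the columns of the
  adjoint of \<open>D\<close>. All are nonnegative, so a sum that is not positive forces every
  column to vanish; this is the source of uniqueness of the minimizer.\<close>

lemma trace_congruence_pos_def:
  fixes Z :: "complex^'n^'n" and D :: "complex^'n^'m"
  assumes "\<And>c. c \<noteq> 0 \<Longrightarrow> 0 < Re (cinner c (Z *v c))"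
  shows "0 \<le> Re (trace (D ** Z ** ctranspose D))"
    and "Re (trace (D ** Z ** ctranspose D)) \<le> 0 \<Longrightarrow> D = 0"
proof -
  have nonneg: "0 \<le> Re (cinner c (Z *v c))" for c
    using assms[of c] by (cases "c = 0") (auto simp: cinner_def)
  then show "0 \<le> Re (trace (D ** Z ** ctranspose D))"
    unfolding Re_trace_congruence by (intro sum_nonneg)
  assume "Re (trace (D ** Z ** ctranspose D)) \<le> 0"
  then have "(\<Sum>i\<in>UNIV. Re (cinner (ctranspose D *v axis i 1) (Z *v (ctranspose D *v axis i 1)))) = 0"
    using nonneg unfolding Re_trace_congruence by (intro antisym sum_nonneg)
  then have "Re (cinner (ctranspose D *v axis i 1) (Z *v (ctranspose D *v axis i 1))) = 0" for i
    using nonneg by (simp add: sum_nonneg_eq_0_iff)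
  then have "ctranspose D *v axis i 1 = 0" for i
    using assms by (metis less_irrefl)
  then show "D = 0"
    by (auto simp: matrix_vector_mult_axis_nth ctranspose_def vec_eq_iff)
qed

text \<open>With \<open>u = B\<^sup>H c\<close> and \<open>q = A\<^sup>H c\<close> one has \<open>Z q = d R c\<close>, so \<open>q\<^sup>H Z q\<close> is the term subtracted in \<open>C\<close>.\<close>
lemma complete_square:
  fixes R Z :: "complex^'n^'n"
  assumes R: "ctranspose R = R" and Z: "ctranspose Z = Z" "invertible Z"
    and A: "A = mat (cnj d) ** R ** matrix_inv Z"
    and C: "C = R - (cmod d)\<^sup>2 *\<^sub>R (R ** matrix_inv Z ** R)"
  shows "Re (cinner c ((C + (B - A) ** Z ** ctranspose (B - A)) *v c))
    = Re (cinner c (R *v c)) - 2 * Re (d * cinner (ctranspose B *v c) (R *v c))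
      + Re (cinner (ctranspose B *v c) (Z *v (ctranspose B *v c)))"
proof -
  define u where "u = ctranspose B *v c"
  define q where "q = ctranspose A *v c"
  have q: "q = matrix_inv Z *v (d *s (R *v c))"
    by (simp add: q_def A ctranspose_mul ctranspose_mat ctranspose_matrix_inv Z R
        matrix_vector_mul_assoc[symmetric] mat_mult_vector vec.scale)
  have Zq: "Z *v q = d *s (R *v c)"
    unfolding q by (simp add: matrix_vector_mul_assoc matrix_inv_right Z)
  have "cinner q (Z *v q) = cinner (d *s (R *v c)) (matrix_inv Z *v (d *s (R *v c)))"
    using cinner_matrix_vector_mult[of q Z q] by (simp add: Z Zq flip: q)
  also have "\<dots> = (cmod d)\<^sup>2 *\<^sub>R cinner c ((R ** matrix_inv Z ** R) *v c)"
    by (simp add: vec.scale cinner_scale_left cinner_scale_right cinner_matrix_vector_mult[of c R] R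
        matrix_vector_mul_assoc[symmetric] scaleR_conv_of_real complex_norm_square del: of_real_power)
  finally have qq: "cinner q (Z *v q) = (cmod d)\<^sup>2 *\<^sub>R cinner c ((R ** matrix_inv Z ** R) *v c)" .
  have uq: "cinner u (Z *v q) = d * cinner u (R *v c)"
    by (simp add: Zq cinner_scale_right)
  \<comment> \<open>For Hermitian \<open>Z\<close> the two cross terms are conjugates, so their real
    parts coincide and add up to the factor 2.\<close>
  have "cinner q (Z *v u) = cnj (cinner u (Z *v q))"
    using cinner_matrix_vector_mult[of q Z u] by (simp add: Z cnj_cinner)
  then have qu: "Re (cinner q (Z *v u)) = Re (d * cinner u (R *v c))"
    by (simp add: uq)
  have "ctranspose (B - A) *v c = u - q"
    by (simp add: u_def q_def ctranspose_diff matrix_vector_mult_diff_rdistrib)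
  then have "cinner c ((C + (B - A) ** Z ** ctranspose (B - A)) *v c)
      = cinner c (R *v c) - cinner q (Z *v q) + cinner (u - q) (Z *v (u - q))"
    by (simp add: C matrix_vector_mult_add_rdistrib matrix_vector_mult_diff_rdistrib cinner_add_right
        cinner_diff_right cinner_diff_left
        cinner_congruence scaleR_matrix_vector cinner_scaleR_right qq)
  \<comment> \<open>The term \<open>q^H Z q\<close> from the square cancels the one subtracted in
    \<open>C\<close>.\<close>
  also have "\<dots> = cinner c (R *v c) + cinner u (Z *v u) - cinner u (Z *v q) - cinner q (Z *v u)"
    by (simp add: cinner_diff_right cinner_diff_left vec.diff)
  finally show ?thesis
    using uq qu by (simp add: u_def)
qed

section \<open>The LMMSE estimator, its uniqueness and its error covariance\<close>

theorem theorem1: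
  fixes M :: "'a measure"
    and h \<eta>\<^sub>r \<nu>noise \<nu>interf \<nu> z hhat :: "'a \<Rightarrow> complex^'n"
    and \<eta>\<^sub>t :: "'a \<Rightarrow> complex"
    and d :: complex
    and p \<kappa>\<^sub>t \<kappa>\<^sub>r \<sigma> :: real
    and R Rdiag S Zbar A C :: "complex^'n^'n"
  assumes "prob_space M"
    and "p = (cmod d)\<^sup>2"
    and "\<kappa>\<^sub>t \<ge> 0" and "\<kappa>\<^sub>r \<ge> 0" and "\<sigma>\<^sup>2 > 0"
    and "psd R" and "psd S"
    and "complex_normal_rv M h R"
    and "\<exists>K. (\<forall>x. complex_normal_vec (K x)
                  ((\<kappa>\<^sub>r * p) *\<^sub>R diag_mat (\<chi> i. complex_of_real ((cmod (x $ i))\<^sup>2)))) \<and>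
             regular_cond_distr M (\<lambda>\<omega>. (\<eta>\<^sub>t \<omega>, \<eta>\<^sub>r \<omega>)) h
               (\<lambda>x. complex_normal (\<kappa>\<^sub>t * p) \<Otimes>\<^sub>M K x)"
    and "complex_normal_rv M \<nu>noise (mat (complex_of_real (\<sigma>\<^sup>2)))"
    and "zero_mean_with_cov M \<nu>interf S"
    and "indep_rv M \<nu>noise \<nu>interf"
    and "\<nu> = (\<lambda>\<omega>. \<nu>noise \<omega> + \<nu>interf \<omega>)"
    and "indep_rv M \<nu> (\<lambda>\<omega>. (h \<omega>, \<eta>\<^sub>t \<omega>, \<eta>\<^sub>r \<omega>))"
    and "z = (\<lambda>\<omega>. (d + \<eta>\<^sub>t \<omega>) *s h \<omega> + \<eta>\<^sub>r \<omega> + \<nu> \<omega>)"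
    and "Rdiag = diag_mat (\<chi> i. R $ i $ i)"
    and "Zbar = (p * (1 + \<kappa>\<^sub>t)) *\<^sub>R R + (p * \<kappa>\<^sub>r) *\<^sub>R Rdiag + S + mat (complex_of_real (\<sigma>\<^sup>2))"
    and "A = mat (cnj d) ** R ** matrix_inv Zbar"
    and "hhat = (\<lambda>\<omega>. A *v z \<omega>)"
    and "C = R - p *\<^sub>R (R ** matrix_inv Zbar ** R)"
  shows "integrable M (\<lambda>\<omega>. outer (z \<omega>) (z \<omega>)) \<and>
         (\<integral>\<omega>. outer (z \<omega>) (z \<omega>) \<partial>M) = Zbar \<and>
         invertible Zbar \<and>
         (\<forall>B. integrable M (\<lambda>\<omega>. (norm (B *v z \<omega> - h \<omega>))\<^sup>2)) \<and>
         (\<forall>B. is_lmmse M h z B \<longleftrightarrow> B = A) \<and>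
         integrable M (\<lambda>\<omega>. outer (hhat \<omega> - h \<omega>) (hhat \<omega> - h \<omega>)) \<and>
         (\<integral>\<omega>. outer (hhat \<omega> - h \<omega>) (hhat \<omega> - h \<omega>) \<partial>M) = C \<and>
         complex_of_real (mse M h hhat) = trace C"
proof -
  note ps = assms(1) and p = assms(2) and h = assms(8) and z = assms(15) and Zbar = assms(17)
  interpret prob_space M by fact
  \<comment> \<open>The covariance of \<open>z - d h\<close>, the part of the observation
    uncorrelated with \<open>h\<close>.\<close>
  define W where "W = (\<kappa>\<^sub>t * p) *\<^sub>R R + (\<kappa>\<^sub>r * p) *\<^sub>R diag_mat (\<chi> i. R $ i $ i)
      + (S + mat (complex_of_real (\<sigma>\<^sup>2)))"
  have R: "ctranspose R = R" "\<And>c. 0 \<le> Re (cinner c (R *v c))"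
    and S: "ctranspose S = S" "\<And>c. 0 \<le> Re (cinner c (S *v c))"
    using assms(6,7) by (simp_all add: psd_def)
  have p0: "0 \<le> p" by (simp add: p)
  have ZW: "Zbar = p *\<^sub>R R + W"
    by (simp add: Zbar W_def assms(16) algebra_simps)
  have Zbar_herm: "ctranspose Zbar = Zbar"
  proof -
    have "cnj (R $ i $ i) = R $ i $ i" for i
      using arg_cong[OF R(1), of "\<lambda>Q. Q $ i $ i"] by (simp add: ctranspose_def)
    then have "ctranspose Rdiag = Rdiag"
      by (auto simp: assms(16) ctranspose_def diag_mat_def vec_eq_iff)
    then show ?thesis
      by (simp add: Zbar ctranspose_add ctranspose_scaleR ctranspose_mat R S)
  qed
  \<comment> \<open>Strict positivity comes from the receiver noise; the other three terms are only
    nonnegative.\<close>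
  have Zbar_pos: "0 < Re (cinner c (Zbar *v c))" if "c \<noteq> 0" for c
  proof -
    have "Re (cinner c (Zbar *v c)) = p * (1 + \<kappa>\<^sub>t) * Re (cinner c (R *v c))
        + p * \<kappa>\<^sub>r * Re (cinner c (Rdiag *v c)) + Re (cinner c (S *v c)) + \<sigma>\<^sup>2 * (norm c)\<^sup>2"
      by (simp add: Zbar matrix_vector_mult_add_rdistrib cinner_add_right scaleR_matrix_vector
          cinner_scaleR_right mat_mult_vector cinner_scale_right cinner_same flip: of_real_power of_real_mult)
    moreover have "0 \<le> p * (1 + \<kappa>\<^sub>t) * Re (cinner c (R *v c))" "0 \<le> p * \<kappa>\<^sub>r * Re (cinner c (Rdiag *v c))"
      using p0 assms(3,4) R(2) diag_mat_diagonal_nonneg[OF R(2), of c] by (simp_all add: assms(16))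
    moreover have "0 < \<sigma>\<^sup>2 * (norm c)\<^sup>2"
      using assms(5) that by simp
    ultimately show ?thesis
      using S(2)[of c] by linarith
  qed
  then have Zbar_inv: "invertible Zbar"
    by (rule invertible_if_pos_def)
  have \<nu>: "centered M (\<lambda>\<omega>. cinner c (\<nu> \<omega>)) (Re (cinner c ((S + mat (complex_of_real (\<sigma>\<^sup>2))) *v c)))" for c
    using centered_indep_add[OF ps indep_rv_indep_var[OF ps assms(12) borel_measurable_cinner borel_measurable_cinner]
        zero_mean_with_cov_centered[OF ps assms(11)] complex_normal_rv_centered[OF assms(10)], of c c]
    by (simp add: assms(13) cinner_add_right matrix_vector_mult_add_rdistrib add.commute)
  obtain K where K: "\<And>x. complex_normal_vec (K x) ((\<kappa>\<^sub>r * p) *\<^sub>R diag_mat (\<chi> i. complex_of_real ((cmod (x $ i))\<^sup>2)))"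
    and rcd: "regular_cond_distr M (\<lambda>\<omega>. (\<eta>\<^sub>t \<omega>, \<eta>\<^sub>r \<omega>)) h (\<lambda>x. complex_normal (\<kappa>\<^sub>t * p) \<Otimes>\<^sub>M K x)"
    using assms(9) by blast
  have v: "0 \<le> \<kappa>\<^sub>t * p" "0 \<le> \<kappa>\<^sub>r * p"
    using p0 assms(3,4) by simp_all
  note obs = observation_second_moment[OF ps h v K rcd \<nu> assms(14), folded W_def]
  have [measurable]: "h \<in> borel_measurable M"
    using h by (simp add: complex_normal_rv_def)
  \<comment> \<open>Measurability of the distortions is extracted from the independence hypothesis,
    which contains that of the whole triple.\<close>
  have "(\<lambda>\<omega>. (h \<omega>, \<eta>\<^sub>t \<omega>, \<eta>\<^sub>r \<omega>)) \<in> M \<rightarrow>\<^sub>M borel \<Otimes>\<^sub>M (borel \<Otimes>\<^sub>M borel)" "\<nu> \<in> borel_measurable M"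
    using assms(14) by (simp_all add: indep_rv_def borel_prod)
  then have [measurable]: "\<eta>\<^sub>t \<in> borel_measurable M" "\<eta>\<^sub>r \<in> borel_measurable M" "\<nu> \<in> borel_measurable M"
    by (simp_all add: measurable_pair_iff comp_def)
  have "continuous_on UNIV (\<lambda>x. fst x *s snd x :: complex^'n)"
    unfolding vector_scalar_mult_def by (intro continuous_intros)
  then have [measurable]: "(\<lambda>\<omega>. (d + \<eta>\<^sub>t \<omega>) *s h \<omega>) \<in> borel_measurable M"
    using borel_measurable_continuous_Pair[of "\<lambda>\<omega>. d + \<eta>\<^sub>t \<omega>" M h "\<lambda>a x. a *s x"] by simp
  have z_meas [measurable]: "z \<in> borel_measurable M"
    unfolding z by measurable
  \<comment> \<open>The factor \<open>cnj d\<close> occurs in both arguments of the form, which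
    produces \<open>p\<close>.\<close>
  have form_Z: "Re (cinner (cnj d *s u) (R *v (cnj d *s u))) + Re (cinner u (W *v u)) = Re (cinner u (Zbar *v u))" for u
    by (simp add: ZW vec.scale cinner_scale_left cinner_scale_right matrix_vector_mult_add_rdistrib
        cinner_add_right scaleR_matrix_vector cinner_scaleR_right p cmod_power2)
      (simp add: power2_eq_square algebra_simps)
  have "cinner 0 x = 0" for x :: "complex^'n"
    by (simp add: cinner_def)
  then have "(\<integral>\<^sup>+ \<omega>. ennreal ((cmod (cinner u (z \<omega>)))\<^sup>2) \<partial>M) = ennreal (Re (cinner u (Zbar *v u)))"
    "0 \<le> Re (cinner u (Zbar *v u))" for u
    using obs[where d=d and u=u and w=0] by (simp_all only: z add_0_right form_Z)
  note zz = integral_outer_eqI[OF z_meas Zbar_herm this]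
  \<comment> \<open>The error covariance claimed for an arbitrary estimator
    \<open>B z\<close>.\<close>
  let ?P = "\<lambda>B. C + (B - A) ** Zbar ** ctranspose (B - A)"
  have P_herm: "ctranspose (?P B) = ?P B" for B
    by (simp add: assms(20) ctranspose_add ctranspose_diff ctranspose_scaleR ctranspose_mul ctranspose_ctranspose
        ctranspose_matrix_inv Zbar_herm Zbar_inv R matrix_mul_assoc)
  \<comment> \<open>The error of \<open>B z\<close>, tested against \<open>c\<close>, has the shape
    of \<open>observation_second_moment\<close> with \<open>u = B^H c\<close> and
    \<open>w = - c\<close>.\<close>
  have err: "cinner c (B *v x - y) = cinner (ctranspose B *v c) x + cinner (- c) y" for c x y and B :: "complex^'n^'n"
    by (simp add: cinner_diff_right cinner_matrix_vector_mult) (simp add: cinner_def sum_negf)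
  have form_P: "Re (cinner (cnj d *s u + - c) (R *v (cnj d *s u + - c))) + Re (cinner u (W *v u))
      = Re (cinner c (?P B *v c))" if u: "u = ctranspose B *v c" for u c B
  proof -
    have "cinner c (R *v (cnj d *s u)) = cnj (cinner (cnj d *s u) (R *v c))"
      using cinner_matrix_vector_mult[of c R "cnj d *s u"] by (simp add: R cnj_cinner)
    then have "Re (cinner c (R *v (cnj d *s u))) = Re (d * cinner u (R *v c))"
      by (simp add: cinner_scale_left)
    then have "Re (cinner (cnj d *s u + - c) (R *v (cnj d *s u + - c)))
        = Re (cinner (cnj d *s u) (R *v (cnj d *s u))) - 2 * Re (d * cinner u (R *v c)) + Re (cinner c (R *v c))"
      by (simp add: cinner_diff_left cinner_diff_right vec.diff cinner_scale_left)
    then show ?thesis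
      using form_Z[of u] complete_square[OF R(1) Zbar_herm Zbar_inv assms(18) assms(20)[unfolded p], of c B]
      unfolding p u[symmetric] by linarith
  qed
  have mB [measurable]: "(\<lambda>\<omega>. B *v z \<omega> - h \<omega>) \<in> borel_measurable M" for B
  proof -
    have "continuous_on UNIV (\<lambda>x. B *v x)"
      unfolding matrix_vector_mult_def by (intro continuous_intros)
    then have [measurable]: "(\<lambda>x. B *v x) \<in> borel_measurable borel"
      by (rule borel_measurable_continuous_onI)
    show ?thesis by measurable
  qed
  have q: "(\<integral>\<^sup>+ \<omega>. ennreal ((cmod (cinner c (B *v z \<omega> - h \<omega>)))\<^sup>2) \<partial>M) = ennreal (Re (cinner c (?P B *v c)))" 
    "0 \<le> Re (cinner c (?P B *v c))" for B c
    using obs[where d=d and u="ctranspose B *v c" and w="- c"]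
    by (simp_all only: z err form_P[OF refl])
  note ee = integral_outer_eqI[OF mB P_herm q]
  \<comment> \<open>The excess mean square error of \<open>B\<close> over \<open>A\<close>. It is
    nonnegative and vanishes only at \<open>B = A\<close>.\<close>
  define T where "T B = Re (trace ((B - A) ** Zbar ** ctranspose (B - A)))" for B
  have mse: "mse M h (\<lambda>\<omega>. B *v z \<omega>) = Re (trace C) + T B" for B
    using ee(4)[of B] by (simp add: mse_def trace_add T_def)
  have T: "0 \<le> T B" "T B \<le> 0 \<longleftrightarrow> B = A" for B
    using trace_congruence_pos_def[OF Zbar_pos, of "B - A"] by (auto simp: T_def trace_def)
  \<comment> \<open>The constant \<open>Re (trace C)\<close> cancels when two estimators are
    compared, so only the excess is minimized.\<close>
  have "is_lmmse M h z B \<longleftrightarrow> (\<forall>Y. T B \<le> T Y)" for B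
    by (auto simp: is_lmmse_def is_arg_min_def not_less mse)
  moreover have "(\<forall>Y. T B \<le> T Y) \<longleftrightarrow> B = A" for B
  proof
    assume "\<forall>Y. T B \<le> T Y"
    then have "T B \<le> T A" ..
    with T(2)[of A] have "T B \<le> 0" by simp
    then show "B = A" by (simp add: T)
  next
    assume "B = A"
    then have "T B \<le> 0" by (simp add: T)
    then show "\<forall>Y. T B \<le> T Y" using T(1) order_trans by blast
  qed
  ultimately have lmmse: "is_lmmse M h z B \<longleftrightarrow> B = A" for B
    by simp
  have PA: "?P A = C"
    by simp
  have "T A = 0"
    using T(1)[of A] T(2)[of A] by simp
  then have "complex_of_real (mse M h (\<lambda>\<omega>. A *v z \<omega>)) = trace C"
    using of_real_Re_trace[OF P_herm[of A, unfolded PA]] by (simp add: mse)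
  with zz(1,2) Zbar_inv ee(1,2)[of A, unfolded PA] ee(3) lmmse show ?thesis
    unfolding assms(19) by blast
qed

end
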